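(* Fix any admissible shared class constants $(\beta,\bar b,c_-,c_+,\tau,\bar s_0,s_R,s_A)$. The shape index $\alpha$ is identifiable over $\mathcal{M}_{\mathrm{reg}}$: if $(F_S,K),(F_S',K')\in\mathcal{M}_{\mathrm{reg}}$ satisfy $KF_S=K'F_S'$, then their A1 shape indices agree, $\alpha=\alpha'$. Moreover, for every member $(F_S,K)\in\mathcal{M}_{\mathrm{reg}}$ with A1 parameters $(\alpha,L)$, apparent endpoint $a=\ell(0+)$ and observed law $Q=KF_S$, for all sufficiently small $h>0$, $$\varkappa_-\,L\,h^{\alpha+\beta+2}\;\le\;Q([a,a+h])\;\le\;\varkappa_+\,L\,h^{\alpha+\beta+2},$$ with $$\varkappa_-=\tfrac12\,\underline{c}\,c_+^{-(\alpha+1)}B(\alpha+1,\beta+2),\qquad \varkappa_+=2\,\overline{c}\,c_-^{-(\alpha+1)}B(\alpha+1,\beta+2),$$ where $\underline{c}=\liminf_{s\downarrow 0}c_K(s)$, $\overline{c}=\limsup_{s\downarrow 0}c_K(s)$ and $B$ is the Euler Beta function.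
   Context: A pair $(F_S,K)$ consists of a Borel probability law $F_S$ on $[0,\infty)$ and a Markov kernel $K$ from $[0,\infty)$ to $[0,\infty]$ such that $K([0,\infty)\mid s)>0$ for every $s\ge 0$. Its observed law is the Borel probability $KF_S$ on $[0,\infty]$, $(KF_S)(B)=\int_{[0,\infty)}K(B\mid s)\,F_S(ds)$. With $\operatorname{supp}$ the topological support in $[0,\infty]$, put $\ell(s):=\inf(\operatorname{supp}K(\cdot\mid s)\cap[0,\infty))$, $u(s):=\sup(\operatorname{supp}K(\cdot\mid s)\cap[0,\infty))$, $w(s):=u(s)-\ell(s)$, $m(s):=\tfrac12(\ell(s)+u(s))-s$. Admissible shared class constants (common to all members): $\beta\ge 0$, $\bar b<\infty$, $0<c_-\le c_+<\infty$, $\bar s_0>0$, $s_R,s_A\in(0,\bar s_0]$, $0<\tau<s_R$. Axioms: A1: $F_S(\{0\})=0$ and there are $s_0\ge\bar s_0$, $L\in(0,\infty)$, $\alpha\in[0,\infty)$ (member-specific) such that $F_S$ has a density $f_S$ on $(0,s_0)$ (a fixed version) with $f_S(s)=Ls^{\alpha}(1+o(1))$ pointwise as $s\downarrow 0$. A2: $w(s)<\infty$ for every $s\ge 0$, and $K(\{+\infty\}\mid s)=0$ for all $s\in[0,s_A]$. A3: $\sup_{s\ge 0}|m(s)|\le\bar b$ and $m\not\equiv 0$. A4: $\lim_{s\downarrow 0}w(s)/s=\infty$. NA: there is no Borel probability $\mu$ on $\mathbb{R}$ such that for $F_S$-a.e. $s$ one has $K(\{+\infty\}\mid s)=0$ and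 $K(B\mid s)=\mu(B-s)$ for every Borel $B\subseteq[0,\infty)$. A5: the limit $a:=\ell(0+)\in[0,\infty)$ exists and, with the convention $\ell(0):=a$, $c_-(s'-s)\le\ell(s')-\ell(s)\le c_+(s'-s)$ for all $0\le s\le s'\le s_R$, and $\ell$ is nondecreasing on $[0,\infty)$. A6: there is a map $c_K:(0,s_R]\to(0,\infty)$ with $0<\liminf_{s\downarrow 0}c_K(s)\le\limsup_{s\downarrow 0}c_K(s)<\infty$ such that for every $\varepsilon>0$ there is $\eta(\varepsilon)>0$ with $(1-\varepsilon)c_K(s)\delta^{\beta+1}\le K([\ell(s),\ell(s)+\delta]\mid s)\le(1+\varepsilon)c_K(s)\delta^{\beta+1}$ for all $s\in(0,s_R]$, $\delta\in(0,\eta(\varepsilon)]$. The regularity class $\mathcal{M}_{\mathrm{reg}}$ is the set of all pairs satisfying A1--A6 and NA with the given shared constants. *)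

theory Defs
  imports "HOL-Probability.Probability" "HOL-Library.Landau_Symbols"
begin

text \<open>
  The half-line $[0,\infty)$ is the subspace \<open>{0..}\<close> of the reals, the extended half-line
  $[0,\infty]$ is the type \<^typ>\<open>ennreal\<close>. A kernel is a function on the reals of which only
  the values on \<open>{0..}\<close> matter. The observed law $K F_S$ is the Giry bind \<open>F \<bind> K\<close>.
\<close>

abbreviation half_line :: "real measure" where
  "half_line \<equiv> restrict_space borel {0..}"

definition kernel_pair :: "real measure \<Rightarrow> (real \<Rightarrow> ennreal measure) \<Rightarrow> bool" where
  "kernel_pair F K \<longleftrightarrow>
     F \<in> space (prob_algebra half_line) \<and>
     K \<in> half_line \<rightarrow>\<^sub>M prob_algebra borel \<and>
     (\<forall>s\<ge>0. emeasure (K s) {0..<\<infinity>} > 0)"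

definition msupport :: "'a::topological_space measure \<Rightarrow> 'a set" where
  "msupport M = {x. \<forall>U. open U \<and> x \<in> U \<longrightarrow> emeasure M U > 0}"

definition fin_supp :: "(real \<Rightarrow> ennreal measure) \<Rightarrow> real \<Rightarrow> real set" where
  "fin_supp K s = {x. 0 \<le> x \<and> ennreal x \<in> msupport (K s)}"

text \<open>
  For a kernel pair and $s \ge 0$ the set \<open>fin_supp K s\<close> is nonempty and bounded below, so the
  lower endpoint is a genuine real infimum. The upper endpoint may be infinite and hence lives in
  \<^typ>\<open>ereal\<close>, as do the width and the midpoint offset.
\<close>

definition lower_end :: "(real \<Rightarrow> ennreal measure) \<Rightarrow> real \<Rightarrow> real" where
  "lower_end K s = Inf (fin_supp K s)"

definition upper_end :: "(real \<Rightarrow> ennreal measure) \<Rightarrow> real \<Rightarrow> ereal" where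
  "upper_end K s = (SUP x\<in>fin_supp K s. ereal x)"

definition width :: "(real \<Rightarrow> ennreal measure) \<Rightarrow> real \<Rightarrow> ereal" where
  "width K s = upper_end K s - ereal (lower_end K s)"

definition mid_offset :: "(real \<Rightarrow> ennreal measure) \<Rightarrow> real \<Rightarrow> ereal" where
  "mid_offset K s = (ereal (lower_end K s) + upper_end K s) / 2 - ereal s"

text \<open>
  \<open>A1_params s0bar F \<alpha> L\<close>: axiom A1 holds for $F$ with shape index $\alpha$ and constant $L$.
\<close>

definition A1_params :: "real \<Rightarrow> real measure \<Rightarrow> real \<Rightarrow> real \<Rightarrow> bool" where
  "A1_params s0bar F \<alpha> L \<longleftrightarrow>
     emeasure F {0} = 0 \<and> L > 0 \<and> \<alpha> \<ge> 0 \<and>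
     (\<exists>s0\<ge>s0bar. \<exists>f :: real \<Rightarrow> real.
        set_borel_measurable borel {0<..<s0} f \<and>
        (\<forall>s\<in>{0<..<s0}. f s \<ge> 0) \<and>
        (\<forall>B\<in>sets borel. B \<subseteq> {0<..<s0} \<longrightarrow>
           emeasure F B = (\<integral>\<^sup>+s\<in>B. ennreal (f s) \<partial>lborel)) \<and>
        f \<sim>[at_right 0] (\<lambda>s. L * s powr \<alpha>))"

definition A1 :: "real \<Rightarrow> real measure \<Rightarrow> bool" where
  "A1 s0bar F \<longleftrightarrow> (\<exists>\<alpha> L. A1_params s0bar F \<alpha> L)"

definition A2 :: "real \<Rightarrow> (real \<Rightarrow> ennreal measure) \<Rightarrow> bool" where
  "A2 sA K \<longleftrightarrow>
     (\<forall>s\<ge>0. width K s < \<infinity>) \<and> (\<forall>s\<in>{0..sA}. emeasure (K s) {\<infinity>} = 0)"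

definition A3 :: "real \<Rightarrow> (real \<Rightarrow> ennreal measure) \<Rightarrow> bool" where
  "A3 bbar K \<longleftrightarrow>
     (SUP s\<in>{0..}. \<bar>mid_offset K s\<bar>) \<le> ereal bbar \<and> (\<exists>s\<ge>0. mid_offset K s \<noteq> 0)"

definition A4 :: "(real \<Rightarrow> ennreal measure) \<Rightarrow> bool" where
  "A4 K \<longleftrightarrow> ((\<lambda>s. width K s / ereal s) \<longlongrightarrow> \<infinity>) (at_right 0)"

definition NA :: "real measure \<Rightarrow> (real \<Rightarrow> ennreal measure) \<Rightarrow> bool" where
  "NA F K \<longleftrightarrow>
     \<not> (\<exists>\<mu> \<in> space (prob_algebra (borel :: real measure)).
          AE s in F. emeasure (K s) {\<infinity>} = 0 \<and>
            (\<forall>B\<in>sets borel. B \<subseteq> {0..} \<longrightarrow>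
               emeasure (K s) (ennreal ` B) = emeasure \<mu> ((\<lambda>x. x - s) ` B)))"

text \<open>
  The \<open>let\<close> implements the convention $\ell(0) := a$, overriding the value \<open>lower_end K 0\<close>.
\<close>

definition A5 :: "real \<Rightarrow> real \<Rightarrow> real \<Rightarrow> (real \<Rightarrow> ennreal measure) \<Rightarrow> bool" where
  "A5 cminus cplus sR K \<longleftrightarrow>
     (\<exists>a\<ge>0. (lower_end K \<longlongrightarrow> a) (at_right 0) \<and>
        (let l = (lower_end K)(0 := a) in
          (\<forall>s s'. 0 \<le> s \<and> s \<le> s' \<and> s' \<le> sR \<longrightarrow>
             cminus * (s' - s) \<le> l s' - l s \<and> l s' - l s \<le> cplus * (s' - s)) \<and>
          mono_on {0..} l))"

text \<open>
  \<open>A6_coeff \<beta> sR K cK\<close>: axiom A6 holds with the coefficient map $c_K$ (values of \<open>cK\<close> outside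
  $(0,s_R]$ are irrelevant). On $(0,s_R]$ the map is determined by $K$.
\<close>

definition lower_coeff :: "(real \<Rightarrow> real) \<Rightarrow> ereal" where
  "lower_coeff cK = Liminf (at_right 0) (\<lambda>s. ereal (cK s))"

definition upper_coeff :: "(real \<Rightarrow> real) \<Rightarrow> ereal" where
  "upper_coeff cK = Limsup (at_right 0) (\<lambda>s. ereal (cK s))"

definition A6_coeff ::
    "real \<Rightarrow> real \<Rightarrow> (real \<Rightarrow> ennreal measure) \<Rightarrow> (real \<Rightarrow> real) \<Rightarrow> bool" where
  "A6_coeff \<beta> sR K cK \<longleftrightarrow>
     (\<forall>s\<in>{0<..sR}. cK s > 0) \<and>
     0 < lower_coeff cK \<and> lower_coeff cK \<le> upper_coeff cK \<and> upper_coeff cK < \<infinity> \<and>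
     (\<forall>\<epsilon>>0. \<exists>\<eta>>0. \<forall>s\<in>{0<..sR}. \<forall>\<delta>\<in>{0<..\<eta>}.
        (1 - \<epsilon>) * cK s * \<delta> powr (\<beta> + 1)
          \<le> measure (K s) {ennreal (lower_end K s)..ennreal (lower_end K s + \<delta>)} \<and>
        measure (K s) {ennreal (lower_end K s)..ennreal (lower_end K s + \<delta>)}
          \<le> (1 + \<epsilon>) * cK s * \<delta> powr (\<beta> + 1))"

definition A6 :: "real \<Rightarrow> real \<Rightarrow> (real \<Rightarrow> ennreal measure) \<Rightarrow> bool" where
  "A6 \<beta> sR K \<longleftrightarrow> (\<exists>cK. A6_coeff \<beta> sR K cK)"

definition admissible_constants ::
    "real \<Rightarrow> real \<Rightarrow> real \<Rightarrow> real \<Rightarrow> real \<Rightarrow> real \<Rightarrow> real \<Rightarrow> real \<Rightarrow> bool" where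
  "admissible_constants \<beta> bbar cminus cplus \<tau> s0bar sR sA \<longleftrightarrow>
     \<beta> \<ge> 0 \<and> 0 < cminus \<and> cminus \<le> cplus \<and> s0bar > 0 \<and>
     sR \<in> {0<..s0bar} \<and> sA \<in> {0<..s0bar} \<and> 0 < \<tau> \<and> \<tau> < sR"

text \<open>
  The condition $\bar b < \infty$ is implicit in \<open>bbar\<close> being real. The constant \<open>\<tau>\<close> occurs in
  none of the axioms.
\<close>

definition M_reg ::
    "real \<Rightarrow> real \<Rightarrow> real \<Rightarrow> real \<Rightarrow> real \<Rightarrow> real \<Rightarrow> real \<Rightarrow> real \<Rightarrow>
      (real measure \<times> (real \<Rightarrow> ennreal measure)) set" where
  "M_reg \<beta> bbar cminus cplus \<tau> s0bar sR sA =
     {(F, K). kernel_pair F K \<and> A1 s0bar F \<and> A2 sA K \<and> A3 bbar K \<and> A4 K \<and> NA F K \<and>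
        A5 cminus cplus sR K \<and> A6 \<beta> sR K}"

definition kappa_minus :: "real \<Rightarrow> real \<Rightarrow> real \<Rightarrow> (real \<Rightarrow> real) \<Rightarrow> real" where
  "kappa_minus \<alpha> \<beta> cplus cK =
     1/2 * real_of_ereal (lower_coeff cK) * cplus powr (-(\<alpha> + 1)) * Beta (\<alpha> + 1) (\<beta> + 2)"

definition kappa_plus :: "real \<Rightarrow> real \<Rightarrow> real \<Rightarrow> (real \<Rightarrow> real) \<Rightarrow> real" where
  "kappa_plus \<alpha> \<beta> cminus cK =
     2 * real_of_ereal (upper_coeff cK) * cminus powr (-(\<alpha> + 1)) * Beta (\<alpha> + 1) (\<beta> + 2)"

end

theory Submission imports Defs begin

text \<open>
  Let \<open>l\<close> be the lower endpoint. Since $a + c_- s \le l(s) \le a + c_+ s$, the window $[a,a+h]$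
  catches from $K(\cdot\mid s)$ at most the mass of $[l(s), l(s) + h - c_- s]$ and at least that of
  $[l(s), l(s) + h - c_+ s]$. By A6 both are of order $c_K(s)(h - c_\pm s)^{\beta+1}$, and
  integrating against $L s^\alpha\,ds$ gives a scaled Beta integral of order $h^{\alpha+\beta+2}$.
  The observed law has no mass below \<open>a\<close> and positive mass in each window, so it determines \<open>a\<close>,
  and then the growth order of the window mass determines $\alpha$.
\<close>

section \<open>Mass below the support, a Beta integral, and integration against a local
  density\<close>

text \<open>Every point below the infimum of the finite support has an open neighbourhood of measure
  zero. There may be uncountably many of these, so the Lindelof property is used to cover their
  union by countably many, and countable subadditivity finishes.\<close>

lemma emeasure_below_lower_end:
  assumes sets: "sets (K s) = sets borel"
  shows "emeasure (K s) {..<ennreal (lower_end K s)} = 0"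
proof -
  let ?U = "{U. open U \<and> emeasure (K s) U = 0}"
  obtain V where V: "V \<subseteq> ?U" "countable V" "\<Union>V = \<Union>?U"
    by (rule Lindelof[of ?U]) auto
  have "\<Union>V \<in> null_sets (K s)"
    using V by (intro null_sets_UN'[of V "\<lambda>x. x", simplified]) (auto intro!: null_setsI simp: sets)
  moreover have "{..<ennreal (lower_end K s)} \<subseteq> \<Union>?U"
  proof
    fix x assume "x \<in> {..<ennreal (lower_end K s)}"
    then have x: "x < ennreal (lower_end K s)" by simp
    then obtain y where y: "x = ennreal y" "0 \<le> y" by (cases x) auto
    with x have "y < lower_end K s"
      by (metis ennreal_leI not_le)
    moreover have "bdd_below (fin_supp K s)"
      by (intro bdd_belowI[of _ 0]) (auto simp: fin_supp_def)
    ultimately have "y \<notin> fin_supp K s"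
      unfolding lower_end_def by (meson cInf_lower not_le)
    with y show "x \<in> \<Union>?U"
      by (auto simp: fin_supp_def msupport_def)
  qed
  ultimately show ?thesis
    using V(3) by (metis emeasure_mono le_zero_eq null_setsD1 null_setsD2)
qed

text \<open>The substitution s = (h/c) x turns the integrand into the Beta integrand on (0,1). The
  factor \<open>s powr \<alpha>\<close> contributes (h/c)^\<alpha>, the factor h - c s = h (1 - x)
  contributes h^(\<beta>+1), and the Jacobian contributes h/c.\<close>

lemma nn_integral_Beta_scaled:
  fixes \<alpha> \<beta> c h :: real
  assumes "\<alpha> > -1" "\<beta> > -2" "c > 0" "h > 0"
  shows "(\<integral>\<^sup>+s. ennreal (s powr \<alpha> * (h - c * s) powr (\<beta> + 1)) * indicator {0<..<h/c} s \<partial>lborel)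
    = ennreal (c powr (-(\<alpha> + 1)) * h powr (\<alpha> + \<beta> + 2) * Beta (\<alpha> + 1) (\<beta> + 2))"
proof -
  let ?b = "\<lambda>t::real. t powr \<alpha> * (1 - t) powr (\<beta> + 1) * indicator {0<..<1} t"
  have "((\<lambda>t. t powr \<alpha> * (1 - t) powr (\<beta> + 1)) has_integral Beta (\<alpha> + 1) (\<beta> + 2)) {0<..<1}"
    using has_integral_Beta_real[of "\<alpha> + 1" "\<beta> + 2"] assms by (simp add: has_integral_Icc_iff_Ioo add.commute)
  then have "(?b has_integral Beta (\<alpha> + 1) (\<beta> + 2)) UNIV"
    by (subst (asm) has_integral_restrict_UNIV[symmetric])
       (auto elim!: back_subst[of "\<lambda>f. (f has_integral _) UNIV"] simp: indicator_def fun_eq_iff)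
  then have b: "(\<integral>\<^sup>+t. ennreal (?b t) \<partial>lborel) = ennreal (Beta (\<alpha> + 1) (\<beta> + 2))"
    by (intro nn_integral_has_integral_lborel) (auto simp: indicator_def)
  \<comment> \<open>The indicator is part of the identity: s lies in (0, h/c) exactly when x lies in
    (0,1), and elsewhere both sides vanish.\<close>
  have pt: "ennreal (s powr \<alpha> * (h - c * s) powr (\<beta> + 1)) * indicator {0<..<h/c} s
      = ennreal (h powr (\<alpha> + \<beta> + 1) * c powr (-\<alpha>)) * ennreal (?b x)"
    if s: "s = h / c * x" for s x
  proof (cases "0 < x \<and> x < 1")
    case True
    have "s powr \<alpha> * (h - c * s) powr (\<beta> + 1)
        = (h powr \<alpha> * c powr (-\<alpha>) * x powr \<alpha>) * (h powr (\<beta> + 1) * (1 - x) powr (\<beta> + 1))"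
    proof -
      have "s powr \<alpha> = h powr \<alpha> * c powr (-\<alpha>) * x powr \<alpha>"
        unfolding s using assms True by (simp add: powr_mult powr_divide powr_minus field_simps)
      moreover have "h - c * s = h * (1 - x)" using s assms by (simp add: field_simps)
      ultimately show ?thesis using assms True by (simp add: powr_mult)
    qed
    also have "\<dots> = (h powr (\<alpha> + \<beta> + 1) * c powr (-\<alpha>)) * (x powr \<alpha> * (1 - x) powr (\<beta> + 1))"
      using assms by (simp add: powr_add algebra_simps)
    finally have "s powr \<alpha> * (h - c * s) powr (\<beta> + 1) = (h powr (\<alpha> + \<beta> + 1) * c powr (-\<alpha>)) * ?b x"
      using True by simp
    moreover have "s \<in> {0<..<h/c}"
      unfolding s using True assms by (simp add: field_simps)
    ultimately show ?thesis by (simp add: ennreal_mult'[symmetric])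
  next
    case False
    then have "s \<notin> {0<..<h/c}"
      unfolding s using assms by (auto simp: zero_less_divide_iff zero_less_mult_iff divide_simps)
    with False show ?thesis by (auto simp: indicator_def)
  qed
  have "(\<integral>\<^sup>+s. ennreal (s powr \<alpha> * (h - c * s) powr (\<beta> + 1)) * indicator {0<..<h/c} s \<partial>lborel)
     = ennreal (h / c) * (\<integral>\<^sup>+x. ennreal (h powr (\<alpha> + \<beta> + 1) * c powr (-\<alpha>)) * ennreal (?b x) \<partial>lborel)"
    using assms by (subst nn_integral_real_affine[where c = "h / c" and t = 0])
      (simp_all only: pt[OF add_0_left], simp_all)
  also have "\<dots> = ennreal (h / c) * (ennreal (h powr (\<alpha> + \<beta> + 1) * c powr (-\<alpha>)) * ennreal (Beta (\<alpha> + 1) (\<beta> + 2)))"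
    by (subst nn_integral_cmult) (simp_all add: b)
  also have "\<dots> = ennreal ((h / c) * (h powr (\<alpha> + \<beta> + 1) * c powr (-\<alpha>)) * Beta (\<alpha> + 1) (\<beta> + 2))"
    using assms by (simp add: ennreal_mult'[symmetric] mult.assoc)
  also have "(h / c) * (h powr (\<alpha> + \<beta> + 1) * c powr (-\<alpha>)) = c powr (-(\<alpha> + 1)) * h powr (\<alpha> + \<beta> + 2)"
  proof -
    have "h powr (\<alpha> + \<beta> + 2) = h powr (\<alpha> + \<beta> + 1) * h powr 1" 
      by (subst powr_add[symmetric]) (simp add: algebra_simps)
    moreover have "c powr (-(\<alpha> + 1)) = c powr (-\<alpha>) * c powr (-1)"
      by (subst powr_add[symmetric]) (simp add: algebra_simps)
    ultimately show ?thesis using assms by (simp add: powr_minus field_simps)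
  qed
  finally show ?thesis .
qed

text \<open>\<open>F\<close> lives on the half-line, and \<open>f\<close> is measurable and a
  density only on the window (0,r). Pushing \<open>F\<close> to the whole line by the identity and
  cutting both measures down to the window makes them equal as Borel measures, so they integrate
  every \<open>g\<close> alike.\<close>

lemma nn_integral_local_density:
  fixes F :: "real measure" and f :: "real \<Rightarrow> real" and g :: "real \<Rightarrow> ennreal"
  assumes sets: "sets F = sets half_line"
    and f: "set_borel_measurable borel {0<..<r} f"
    and dens: "\<And>B. B \<in> sets borel \<Longrightarrow> B \<subseteq> {0<..<r} \<Longrightarrow>
      emeasure F B = (\<integral>\<^sup>+s\<in>B. ennreal (f s) \<partial>lborel)"
    and g[measurable]: "g \<in> borel_measurable borel"
  shows "(\<integral>\<^sup>+s. g s * indicator {0<..<r} s \<partial>F)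
    = (\<integral>\<^sup>+s. ennreal (f s) * g s * indicator {0<..<r} s \<partial>lborel)"
proof -
  let ?A = "{0<..<r}"
  have id[measurable]: "(\<lambda>x. x) \<in> F \<rightarrow>\<^sub>M borel"
    by (subst measurable_cong_sets[OF sets refl]) (simp add: measurable_restrict_space1)
  have "(\<lambda>s. ennreal (indicator ?A s * f s)) \<in> borel_measurable borel"
    using f unfolding set_borel_measurable_def by simp
  moreover have "ennreal (indicator ?A s * f s) = ennreal (f s) * indicator ?A s" for s
    by (simp add: indicator_def)
  \<comment> \<open>Outside the window nothing is known about \<open>f\<close>, so from here on the
    indicator stays attached to it.\<close>
  ultimately have [measurable]: "(\<lambda>s. ennreal (f s) * indicator ?A s) \<in> borel_measurable borel"
    by simp
  have eq: "density (distr F borel (\<lambda>x. x)) (indicator ?A) = density lborel (\<lambda>s. ennreal (f s) * indicator ?A s)"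
  proof (rule measure_eqI)
    fix B assume "B \<in> sets (density (distr F borel (\<lambda>x. x)) (indicator ?A))"
    then have B[measurable]: "B \<in> sets borel" by simp
    have sp: "space F = {0..}" using sets_eq_imp_space_eq[OF sets] by (simp add: space_restrict_space)
    have "emeasure (density (distr F borel (\<lambda>x. x)) (indicator ?A)) B = emeasure (distr F borel (\<lambda>x. x)) (?A \<inter> B)"
      by (simp add: emeasure_density flip: indicator_inter_arith)
    also have "\<dots> = emeasure F (?A \<inter> B)"
      by (subst emeasure_distr) (auto intro!: arg_cong[where f = "emeasure F"] simp: sp)
    also have "\<dots> = (\<integral>\<^sup>+s\<in>?A \<inter> B. ennreal (f s) \<partial>lborel)" by (rule dens) auto
    also have "\<dots> = emeasure (density lborel (\<lambda>s. ennreal (f s) * indicator ?A s)) B"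
      by (simp add: emeasure_density indicator_inter_arith mult.assoc)
    finally show "emeasure (density (distr F borel (\<lambda>x. x)) (indicator ?A)) B = \<dots>" .
  qed simp
  have "(\<integral>\<^sup>+s. g s * indicator ?A s \<partial>F) = (\<integral>\<^sup>+s. g s \<partial>density (distr F borel (\<lambda>x. x)) (indicator ?A))"
    by (subst nn_integral_density) (simp_all add: nn_integral_distr mult.commute)
  also have "\<dots> = (\<integral>\<^sup>+s. ennreal (f s) * g s * indicator ?A s \<partial>lborel)"
    unfolding eq by (subst nn_integral_density) (simp_all add: mult_ac)
  finally show ?thesis .
qed

section \<open>Consequences of the axioms in usable form\<close>

lemma kernel_pairD:
  assumes "kernel_pair F K"
  shows "sets F = sets half_line" "space F = {0..}" "prob_space F"
    and "s \<ge> 0 \<Longrightarrow> sets (K s) = sets borel" "s \<ge> 0 \<Longrightarrow> prob_space (K s)"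
    and "prob_space (F \<bind> K)"
    and "X \<in> sets borel \<Longrightarrow> emeasure (F \<bind> K) X = (\<integral>\<^sup>+s. emeasure (K s) X \<partial>F)"
    and "X \<in> sets borel \<Longrightarrow> (\<lambda>s. emeasure (K s) X) \<in> borel_measurable F"
    and "sets (F \<bind> K) = sets borel"
proof -
  have F: "F \<in> space (prob_algebra half_line)" and K: "K \<in> half_line \<rightarrow>\<^sub>M prob_algebra borel"
    using assms by (auto simp: kernel_pair_def)
  show sets: "sets F = sets half_line" and "prob_space F"
    using F by (auto simp: space_prob_algebra)
  show sp: "space F = {0..}" using sets_eq_imp_space_eq[OF sets] by (simp add: space_restrict_space)
  show "s \<ge> 0 \<Longrightarrow> sets (K s) = sets borel" "s \<ge> 0 \<Longrightarrow> prob_space (K s)"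
    using measurable_space[OF K, of s] by (auto simp: space_prob_algebra space_restrict_space)
  show "prob_space (F \<bind> K)" using F K by (rule prob_space_bind')
  show "sets (F \<bind> K) = sets borel" using F K by (rule sets_bind')
  \<comment> \<open>The facts about Giry bind speak of subprobability kernels whose source is
    \<open>F\<close> itself. The passage rests on \<open>F\<close> and \<open>half_line\<close>
    having the same measurable sets.\<close>
  have K': "K \<in> F \<rightarrow>\<^sub>M subprob_algebra borel"
    using measurable_prob_algebraD[OF K] by (simp cong: measurable_cong_sets add: sets)
  show "X \<in> sets borel \<Longrightarrow> emeasure (F \<bind> K) X = (\<integral>\<^sup>+s. emeasure (K s) X \<partial>F)"
    by (rule emeasure_bind[OF _ K']) (auto simp: sp)
  show "X \<in> sets borel \<Longrightarrow> (\<lambda>s. emeasure (K s) X) \<in> borel_measurable F"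
    by (rule measurable_emeasure_kernel[OF K'])
qed

text \<open>The endpoint in \<open>A5\<close> is existentially quantified; uniqueness of limits
  identifies it with the given \<open>a\<close>. The two linear bounds are the slope bounds between
  0 and s, read with the convention l(0) = a.\<close>

lemma A5D:
  assumes A5: "A5 cminus cplus sR K" and a: "(lower_end K \<longlongrightarrow> a) (at_right 0)"
  shows "a \<ge> 0"
    and "0 < s \<Longrightarrow> s \<le> sR \<Longrightarrow> a + cminus * s \<le> lower_end K s"
    and "0 < s \<Longrightarrow> s \<le> sR \<Longrightarrow> lower_end K s \<le> a + cplus * s"
    and "0 < s \<Longrightarrow> s \<le> s' \<Longrightarrow> lower_end K s \<le> lower_end K s'"
    and "0 < s \<Longrightarrow> a \<le> lower_end K s"
proof -
  obtain b where b: "b \<ge> 0" "(lower_end K \<longlongrightarrow> b) (at_right 0)"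
    "\<And>s s'. 0 \<le> s \<Longrightarrow> s \<le> s' \<Longrightarrow> s' \<le> sR \<Longrightarrow>
       cminus * (s' - s) \<le> ((lower_end K)(0 := b)) s' - ((lower_end K)(0 := b)) s \<and>
       ((lower_end K)(0 := b)) s' - ((lower_end K)(0 := b)) s \<le> cplus * (s' - s)"
    "mono_on {0..} ((lower_end K)(0 := b))"
    using A5 unfolding A5_def Let_def by blast
  have ab: "b = a" using b(2) a by (intro tendsto_unique) auto
  show "a \<ge> 0" using b ab by simp
  show "0 < s \<Longrightarrow> s \<le> sR \<Longrightarrow> a + cminus * s \<le> lower_end K s"
    and "0 < s \<Longrightarrow> s \<le> sR \<Longrightarrow> lower_end K s \<le> a + cplus * s"
    using b(3)[of 0 s] ab by auto
  show "0 < s \<Longrightarrow> s \<le> s' \<Longrightarrow> lower_end K s \<le> lower_end K s'"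
    using mono_onD[OF b(4), of s s'] by auto
  show "0 < s \<Longrightarrow> a \<le> lower_end K s"
    using mono_onD[OF b(4), of 0 s] ab by auto
qed

text \<open>The coefficients are extended reals, but the chain 0 < liminf \<le> limsup < \<infinity>
  makes both finite, so \<open>real_of_ereal\<close> is faithful and the usual strict bounds hold
  eventually.\<close>

lemma A6_coeffD:
  assumes "A6_coeff \<beta> sR K cK"
  shows "real_of_ereal (lower_coeff cK) > 0" "real_of_ereal (upper_coeff cK) > 0"
    and "x < real_of_ereal (lower_coeff cK) \<Longrightarrow> \<forall>\<^sub>F s in at_right 0. x < cK s"
    and "x > real_of_ereal (upper_coeff cK) \<Longrightarrow> \<forall>\<^sub>F s in at_right 0. cK s < x"
proof -
  have c: "0 < lower_coeff cK" "lower_coeff cK \<le> upper_coeff cK" "upper_coeff cK < \<infinity>"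
    using assms by (auto simp: A6_coeff_def)
  obtain l u where lu: "lower_coeff cK = ereal l" "upper_coeff cK = ereal u" "0 < l" "l \<le> u"
    using c by (cases "lower_coeff cK"; cases "upper_coeff cK") auto
  then show "real_of_ereal (lower_coeff cK) > 0" "real_of_ereal (upper_coeff cK) > 0" by auto
  show "x < real_of_ereal (lower_coeff cK) \<Longrightarrow> \<forall>\<^sub>F s in at_right 0. x < cK s"
    using less_LiminfD[of "ereal x" "at_right 0" "\<lambda>s. ereal (cK s)"] lu by (simp add: lower_coeff_def)
  show "x > real_of_ereal (upper_coeff cK) \<Longrightarrow> \<forall>\<^sub>F s in at_right 0. cK s < x"
    using Limsup_lessD[of "at_right 0" "\<lambda>s. ereal (cK s)" "ereal x"] lu by (simp add: upper_coeff_def)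
qed

section \<open>The observed law near the apparent endpoint\<close>

text \<open>For s > 0 monotonicity gives a \<le> l(s), and the kernel has no mass below l(s). The
  convention l(0) = a says nothing about the true kernel at 0, so that point is discarded as an
  \<open>F\<close>-null set.\<close>

lemma observed_below_endpoint:
  assumes kp: "kernel_pair F K" and F0: "emeasure F {0} = 0"
    and A5: "A5 cminus cplus sR K" and a: "(lower_end K \<longlongrightarrow> a) (at_right 0)"
  shows "emeasure (F \<bind> K) {..<ennreal a} = 0"
proof -
  note kpD = kernel_pairD[OF kp]
  have "AE s in F. s \<noteq> 0"
    by (rule AE_I[of _ _ "{0}"]) (auto simp: F0 kpD sets_restrict_space_iff)
  then have "AE s in F. emeasure (K s) {..<ennreal a} = 0"
    using AE_space
  proof eventually_elim
    case (elim s)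
    then have s: "s > 0" by (simp add: kpD)
    then have "{..<ennreal a} \<subseteq> {..<ennreal (lower_end K s)}"
      using A5D(5)[OF A5 a s] ennreal_leI order_less_le_trans by fastforce
    then have "emeasure (K s) {..<ennreal a} \<le> emeasure (K s) {..<ennreal (lower_end K s)}"
      using s by (intro emeasure_mono) (auto simp: kpD)
    then show ?case using s emeasure_below_lower_end[of K s] by (simp add: kpD)
  qed
  then show ?thesis
    by (simp add: kpD(7) kpD(8) nn_integral_0_iff_AE)
qed

text \<open>For small h only s up to h/c_- can contribute, and there \<open>f\<close>,
  \<open>cK\<close> and the A6 estimate are all under control. For \<open>F\<close>-almost every s
  the kernel mass of the window lies between functions \<open>V\<close> and \<open>U\<close> whose
  integrals against \<open>f\<close> are bounded by scaled Beta integrals.\<close>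

lemma observed_window_bounds:
  assumes kp: "kernel_pair F K" and A1: "A1_params s0bar F \<alpha> L"
    and A5: "A5 cminus cplus sR K" and a: "(lower_end K \<longlongrightarrow> a) (at_right 0)"
    and A6: "A6_coeff \<beta> sR K cK"
    and pos: "\<beta> \<ge> 0" "0 < cminus" "cminus \<le> cplus" "0 < sR" "0 < s0bar"
  shows "\<forall>\<^sub>F h in at_right 0.
           kappa_minus \<alpha> \<beta> cplus cK * L * h powr (\<alpha> + \<beta> + 2)
             \<le> measure (F \<bind> K) {ennreal a..ennreal (a + h)} \<and>
           measure (F \<bind> K) {ennreal a..ennreal (a + h)}
             \<le> kappa_plus \<alpha> \<beta> cminus cK * L * h powr (\<alpha> + \<beta> + 2)"
proof -
  note kpD = kernel_pairD[OF kp] and A5D = A5D[OF A5 a]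
  define cl where "cl = real_of_ereal (lower_coeff cK)"
  define cu where "cu = real_of_ereal (upper_coeff cK)"
  have cl: "cl > 0" and cu: "cu > 0" using A6_coeffD[OF A6] by (auto simp: cl_def cu_def)
  \<comment> \<open>A liminf or limsup only controls values strictly beyond it, hence the ten
    percent slack.\<close>
  have cl': "9/10 * cl < cl" and cu': "11/10 * cu > cu" using cl cu by auto
  have A1': "emeasure F {0} = 0" "L > 0" "\<alpha> \<ge> 0"
    using A1 by (auto simp: A1_params_def)
  obtain s0 f where s0: "s0 \<ge> s0bar" and fm: "set_borel_measurable borel {0<..<s0} f"
    and fnn: "\<And>s. s \<in> {0<..<s0} \<Longrightarrow> f s \<ge> 0"
    and dens: "\<And>B. B \<in> sets borel \<Longrightarrow> B \<subseteq> {0<..<s0} \<Longrightarrow>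
       emeasure F B = (\<integral>\<^sup>+s\<in>B. ennreal (f s) \<partial>lborel)"
    and fa: "f \<sim>[at_right 0] (\<lambda>s. L * s powr \<alpha>)"
    using A1 unfolding A1_params_def by blast
  have ev0: "\<forall>\<^sub>F s in at_right (0::real). 0 < s" by (rule eventually_at_right_less)
  \<comment> \<open>Asymptotic equivalence counts 0/0 as 1. The comparison function is positive for
    s > 0, so here the plain quotient converges.\<close>
  have "((\<lambda>s. f s / (L * s powr \<alpha>)) \<longlongrightarrow> 1) (at_right 0)"
    using ev0 A1' by (intro asymp_equivD_strong[OF fa]) (auto elim!: eventually_mono)
  then have "\<forall>\<^sub>F s in at_right 0. 9/10 < f s / (L * s powr \<alpha>)" "\<forall>\<^sub>F s in at_right 0. f s / (L * s powr \<alpha>) < 11/10"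
    by (rule order_tendstoD; simp)+
  then have "\<forall>\<^sub>F s in at_right 0. 9/10 * (L * s powr \<alpha>) \<le> f s \<and> f s \<le> 11/10 * (L * s powr \<alpha>)
      \<and> 9/10 * cl \<le> cK s \<and> cK s \<le> 11/10 * cu"
    using A6_coeffD(3)[OF A6, of "9/10 * cl", folded cl_def, OF cl'] A6_coeffD(4)[OF A6, of "11/10 * cu", folded cu_def, OF cu'] ev0
  proof eventually_elim
    case (elim s)
    then have "L * s powr \<alpha> > 0" using A1' by simp
    with elim show ?case by (simp add: pos_less_divide_eq pos_divide_less_eq)
  qed
  then obtain r0 where r0: "r0 > 0" "\<And>s. 0 < s \<Longrightarrow> s < r0 \<Longrightarrow>
      9/10 * (L * s powr \<alpha>) \<le> f s \<and> f s \<le> 11/10 * (L * s powr \<alpha>)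
      \<and> 9/10 * cl \<le> cK s \<and> cK s \<le> 11/10 * cu"
    unfolding eventually_at_right_field by auto
  text \<open>
    Relative error $1/10$ in each of $f$, $c_K$ and the A6 estimate suffices, because
    $(11/10)^3 < 2$ and $(9/10)^3 > 1/2$.
  \<close>
  define r where "r = Min {r0, sR, s0}"
  have r: "r > 0" "r \<le> r0" "r \<le> sR" "r \<le> s0" using r0 pos s0 by (auto simp: r_def)
  obtain \<eta> where \<eta>: "\<eta> > 0" "\<And>s \<delta>. s \<in> {0<..sR} \<Longrightarrow> \<delta> \<in> {0<..\<eta>} \<Longrightarrow>
      (1 - 1/10) * cK s * \<delta> powr (\<beta> + 1)
          \<le> measure (K s) {ennreal (lower_end K s)..ennreal (lower_end K s + \<delta>)} \<and>
        measure (K s) {ennreal (lower_end K s)..ennreal (lower_end K s + \<delta>)}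
          \<le> (1 + 1/10) * cK s * \<delta> powr (\<beta> + 1)"
  proof -
    have "\<forall>\<epsilon>>0. \<exists>\<eta>>0. \<forall>s\<in>{0<..sR}. \<forall>\<delta>\<in>{0<..\<eta>}.
        (1 - \<epsilon>) * cK s * \<delta> powr (\<beta> + 1)
          \<le> measure (K s) {ennreal (lower_end K s)..ennreal (lower_end K s + \<delta>)} \<and>
        measure (K s) {ennreal (lower_end K s)..ennreal (lower_end K s + \<delta>)}
          \<le> (1 + \<epsilon>) * cK s * \<delta> powr (\<beta> + 1)" 
      using A6 by (simp add: A6_coeff_def)
    from this[rule_format, of "1/10"] show ?thesis using that by auto
  qed
  have win: "emeasure (F \<bind> K) {ennreal a..ennreal (a + h)}
        \<le> ennreal (kappa_plus \<alpha> \<beta> cminus cK * L * h powr (\<alpha> + \<beta> + 2))"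
    "ennreal (kappa_minus \<alpha> \<beta> cplus cK * L * h powr (\<alpha> + \<beta> + 2))
        \<le> emeasure (F \<bind> K) {ennreal a..ennreal (a + h)}"
    if h: "0 < h" "h < cminus * r" "h < \<eta>" for h
  proof -
    let ?W = "{ennreal a..ennreal (a + h)}"
    \<comment> \<open>Beyond \<open>tm\<close> the lower slope bound lifts l(s) above a + h; before
      \<open>tp\<close> the upper one keeps l(s) inside the window. The condition
      \<open>h < cminus * r\<close> says exactly that \<open>tm < r\<close>.\<close>
    define tm tp where "tm = h / cminus" and "tp = h / cplus"
    have tm: "0 < tm" "tm < r" using h pos by (auto simp: tm_def field_simps)
    have tp: "0 < tp" "tp \<le> tm" using h pos by (auto simp: tm_def tp_def intro!: divide_left_mono)
    have B: "Beta (\<alpha> + 1) (\<beta> + 2) > 0"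
      using A1' pos by (simp add: Beta_def Gamma_real_pos)
    \<comment> \<open>Here 121/100 = (11/10)^2 and 81/100 = (9/10)^2 combine the errors of
      \<open>cK\<close> and of A6. The error of \<open>f\<close> enters on integration and yields
      1331/1000 and 729/1000.\<close>
    define U where "U = (\<lambda>s. ennreal (121/100 * cu * (h - cminus * s) powr (\<beta> + 1)) * indicator {0<..<tm} s)"
    define V where "V = (\<lambda>s. ennreal (81/100 * cl * (h - cplus * s) powr (\<beta> + 1)) * indicator {0<..<tp} s)"
    have Um[measurable]: "U \<in> borel_measurable borel" and Vm[measurable]: "V \<in> borel_measurable borel"
      unfolding U_def V_def by measurable
    have null: "emeasure (K s) ?W = 0" if "s \<ge> 0" "a + h < lower_end K s" for s
    proof -
      have "ennreal (a + h) < ennreal (lower_end K s)"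
        using that A5D(1) h by (intro ennreal_lessI) auto
      then have "?W \<subseteq> {..<ennreal (lower_end K s)}" by (auto simp del: ennreal_plus)
      then have "emeasure (K s) ?W \<le> emeasure (K s) {..<ennreal (lower_end K s)}"
        using that by (intro emeasure_mono) (auto simp: kpD)
      then show ?thesis using that emeasure_below_lower_end[of K s] by (simp add: kpD)
    qed
    have up: "emeasure (K s) ?W \<le> U s" if s: "s > 0" "s \<noteq> tm" for s
    proof (cases "s < tm")
      case True
      define \<delta> where "\<delta> = h - cminus * s"
      have cs: "cminus * s < h" using True pos by (simp add: tm_def field_simps)
      have sr: "s \<le> sR" "s < r0" using True tm r by auto
      have "0 < cminus * s" using s pos by simp
      then have \<delta>: "\<delta> \<in> {0<..\<eta>}" using cs h by (simp add: \<delta>_def)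
      have "a + h \<le> lower_end K s + \<delta>" using A5D(2)[of s] s sr by (simp add: \<delta>_def)
      \<comment> \<open>The part of the window below l(s) is null, and what remains fits into the
        interval that A6 measures.\<close>
      then have sub: "?W \<subseteq> {..<ennreal (lower_end K s)} \<union> {ennreal (lower_end K s)..ennreal (lower_end K s + \<delta>)}"
        by (auto simp: not_le simp del: ennreal_plus dest!: ennreal_leI intro: order_trans)
      interpret Ks: prob_space "K s" using s by (simp add: kpD)
      have "emeasure (K s) ?W \<le> emeasure (K s) {..<ennreal (lower_end K s)}
          + emeasure (K s) {ennreal (lower_end K s)..ennreal (lower_end K s + \<delta>)}"
        using s by (intro order_trans[OF emeasure_mono[OF sub] emeasure_subadditive]) (auto simp: kpD)
      also have "\<dots> = ennreal (measure (K s) {ennreal (lower_end K s)..ennreal (lower_end K s + \<delta>)})"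
        using emeasure_below_lower_end[of K s] s by (simp add: kpD Ks.emeasure_eq_measure)
      also have "\<dots> \<le> ennreal ((1 + 1/10) * cK s * \<delta> powr (\<beta> + 1))"
        using \<eta>(2)[of s \<delta>] s sr \<delta> by (intro ennreal_leI) auto
      also have "\<dots> \<le> ennreal (121/100 * cu * \<delta> powr (\<beta> + 1))"
        using r0(2)[of s] s sr by (intro ennreal_leI mult_right_mono) auto
      finally show ?thesis using s True by (simp add: U_def \<delta>_def)
    next
      case False
      have "a + h < lower_end K s"
      proof (cases "s \<le> r")
        case True
        have "h < cminus * s" using False s pos by (simp add: tm_def field_simps)
        then show ?thesis using A5D(2)[of s] s True r by auto
      next
        \<comment> \<open>Such s may exceed \<open>sR\<close>, where no slope bound holds.
          Monotonicity carries the bound over from r: l(s) \<ge> l(r) \<ge> a + c_- r > a +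
          h.\<close>
        case f: False
        then show ?thesis using A5D(2)[of r] A5D(4)[of r s] r h by auto
      qed
      then show ?thesis using null[of s] s by simp
    qed
    have low: "V s \<le> emeasure (K s) ?W" if s: "s > 0" for s
    proof (cases "s < tp")
      case True
      define \<delta> where "\<delta> = h - cplus * s"
      have cs: "cplus * s < h" using True pos by (simp add: tp_def field_simps)
      have sr: "s \<le> sR" "s < r0" using True tm tp r by auto
      have "0 < cplus * s" using s pos by simp
      then have \<delta>: "\<delta> \<in> {0<..\<eta>}" using cs h by (simp add: \<delta>_def)
      \<comment> \<open>The upper slope bound gives l(s) + \<delta> \<le> a + h, and l(s) \<ge> a
        holds by monotonicity.\<close>
      have sub: "{ennreal (lower_end K s)..ennreal (lower_end K s + \<delta>)} \<subseteq> ?W"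
        using A5D(3)[of s] A5D(5)[of s] s sr by (auto simp: \<delta>_def intro!: ennreal_leI)
      interpret Ks: prob_space "K s" using s by (simp add: kpD)
      have "ennreal (81/100 * cl * \<delta> powr (\<beta> + 1)) \<le> ennreal ((1 - 1/10) * cK s * \<delta> powr (\<beta> + 1))"
        using r0(2)[of s] s sr by (intro ennreal_leI mult_right_mono) auto
      also have "\<dots> \<le> ennreal (measure (K s) {ennreal (lower_end K s)..ennreal (lower_end K s + \<delta>)})"
        using \<eta>(2)[of s \<delta>] s sr \<delta> by (intro ennreal_leI) auto
      also have "\<dots> \<le> emeasure (K s) ?W"
        unfolding Ks.emeasure_eq_measure[symmetric] using s by (intro emeasure_mono sub) (auto simp: kpD)
      finally show ?thesis using s True by (simp add: V_def \<delta>_def)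
    qed (simp add: V_def)
    text \<open>
      At $s = h/c_-$ the remaining window may be the single point $l(s)$, which A6 does not
      address; the density makes this $s$ negligible.
    \<close>
    have ne: "AE s in F. s > 0 \<and> s \<noteq> tm"
    proof -
      have "emeasure F {tm} = (\<integral>\<^sup>+s\<in>{tm}. ennreal (f s) \<partial>lborel)"
        using tm r by (intro dens) auto
      also have "\<dots> = 0" by (simp add: nn_integral_0_iff_AE nn_integral_indicator_singleton)
      finally have "AE s in F. s \<noteq> tm"
        using tm by (intro AE_I[of _ _ "{tm}"]) (auto simp: kpD sets_restrict_space_iff)
      moreover have "AE s in F. s \<noteq> 0"
        by (rule AE_I[of _ _ "{0}"]) (auto simp: A1' kpD sets_restrict_space_iff)
      ultimately show ?thesis using AE_space by eventually_elim (auto simp: kpD)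
    qed
    have "emeasure (F \<bind> K) ?W = (\<integral>\<^sup>+s. emeasure (K s) ?W \<partial>F)" by (simp add: kpD)
    also have "\<dots> \<le> (\<integral>\<^sup>+s. U s \<partial>F)"
      by (intro nn_integral_mono_AE) (rule eventually_mono[OF ne], use up in blast)
    \<comment> \<open>Inserting the indicator changes nothing, since \<open>U\<close> vanishes off
      (0,tm), which lies inside (0,s0). It brings the integral to where \<open>F\<close> has a
      density.\<close>
    also have "\<dots> = (\<integral>\<^sup>+s. U s * indicator {0<..<s0} s \<partial>F)"
      using tm r by (intro nn_integral_cong) (auto simp: U_def indicator_def)
    also have "\<dots> = (\<integral>\<^sup>+s. ennreal (f s) * U s * indicator {0<..<s0} s \<partial>lborel)"
      by (rule nn_integral_local_density[OF kpD(1) fm dens]) auto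
    also have "\<dots> \<le> (\<integral>\<^sup>+s. ennreal (1331/1000 * cu * L) *
        (ennreal (s powr \<alpha> * (h - cminus * s) powr (\<beta> + 1)) * indicator {0<..<h/cminus} s) \<partial>lborel)"
    proof (intro nn_integral_mono)
      fix s :: real
      show "ennreal (f s) * U s * indicator {0<..<s0} s \<le> ennreal (1331/1000 * cu * L) *
        (ennreal (s powr \<alpha> * (h - cminus * s) powr (\<beta> + 1)) * indicator {0<..<h/cminus} s)"
      proof (cases "s \<in> {0<..<tm}")
        case True
        then have s: "0 < s" "s < r0" "s < s0" using tm r by auto
        have "f s * (121/100 * cu * (h - cminus * s) powr (\<beta> + 1))
            \<le> (11/10 * (L * s powr \<alpha>)) * (121/100 * cu * (h - cminus * s) powr (\<beta> + 1))"
          using r0(2)[of s] s cu by (intro mult_right_mono) auto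
        also have "\<dots> = 1331/1000 * cu * L * (s powr \<alpha> * (h - cminus * s) powr (\<beta> + 1))" by simp
        finally show ?thesis
          using True s fnn[of s] cu A1'
          by (simp add: U_def tm_def[symmetric] ennreal_mult'[symmetric] ennreal_leI)
      qed (auto simp: U_def)
    qed
    also have "\<dots> = ennreal (1331/1000 * cu * L) *
        ennreal (cminus powr (-(\<alpha> + 1)) * h powr (\<alpha> + \<beta> + 2) * Beta (\<alpha> + 1) (\<beta> + 2))"
      using A1' pos h by (subst nn_integral_cmult) (simp_all add: nn_integral_Beta_scaled)
    also have "\<dots> = ennreal (1331/1000 * (cu * L *
        (cminus powr (-(\<alpha> + 1)) * h powr (\<alpha> + \<beta> + 2) * Beta (\<alpha> + 1) (\<beta> + 2))))"
      using cu A1' B by (simp add: ennreal_mult'[symmetric] mult.assoc)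
    also have "\<dots> \<le> ennreal (2 * (cu * L *
        (cminus powr (-(\<alpha> + 1)) * h powr (\<alpha> + \<beta> + 2) * Beta (\<alpha> + 1) (\<beta> + 2))))"
      using cu A1' B by (intro ennreal_leI mult_right_mono) auto
    also have "\<dots> = ennreal (kappa_plus \<alpha> \<beta> cminus cK * L * h powr (\<alpha> + \<beta> + 2))"
      by (simp add: kappa_plus_def cu_def mult_ac)
    finally show "emeasure (F \<bind> K) ?W \<le> \<dots>" .
    \<comment> \<open>The lower bound runs through the same chain in the opposite direction, with
      \<open>V\<close> and slope \<open>cplus\<close>.\<close>
    have "ennreal (kappa_minus \<alpha> \<beta> cplus cK * L * h powr (\<alpha> + \<beta> + 2)) = ennreal (1/2 * (cl * L *
        (cplus powr (-(\<alpha> + 1)) * h powr (\<alpha> + \<beta> + 2) * Beta (\<alpha> + 1) (\<beta> + 2))))"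
      by (simp add: kappa_minus_def cl_def mult_ac)
    also have "\<dots> \<le> ennreal (729/1000 * (cl * L *
        (cplus powr (-(\<alpha> + 1)) * h powr (\<alpha> + \<beta> + 2) * Beta (\<alpha> + 1) (\<beta> + 2))))"
      using cl A1' B by (intro ennreal_leI mult_right_mono) auto
    also have "\<dots> = ennreal (729/1000 * cl * L) *
        ennreal (cplus powr (-(\<alpha> + 1)) * h powr (\<alpha> + \<beta> + 2) * Beta (\<alpha> + 1) (\<beta> + 2))"
      using cl A1' B by (simp add: ennreal_mult'[symmetric] mult.assoc)
    also have "\<dots> = (\<integral>\<^sup>+s. ennreal (729/1000 * cl * L) *
        (ennreal (s powr \<alpha> * (h - cplus * s) powr (\<beta> + 1)) * indicator {0<..<h/cplus} s) \<partial>lborel)"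
      using A1' pos h by (subst nn_integral_cmult) (simp_all add: nn_integral_Beta_scaled)
    also have "\<dots> \<le> (\<integral>\<^sup>+s. ennreal (f s) * V s * indicator {0<..<s0} s \<partial>lborel)"
    proof (intro nn_integral_mono)
      fix s :: real
      show "ennreal (729/1000 * cl * L) *
        (ennreal (s powr \<alpha> * (h - cplus * s) powr (\<beta> + 1)) * indicator {0<..<h/cplus} s)
        \<le> ennreal (f s) * V s * indicator {0<..<s0} s"
      proof (cases "s \<in> {0<..<tp}")
        case True
        then have s: "0 < s" "s < r0" "s < s0" using tp tm r by auto
        have "729/1000 * cl * L * (s powr \<alpha> * (h - cplus * s) powr (\<beta> + 1))
            = (9/10 * (L * s powr \<alpha>)) * (81/100 * cl * (h - cplus * s) powr (\<beta> + 1))" by simp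
        also have "\<dots> \<le> f s * (81/100 * cl * (h - cplus * s) powr (\<beta> + 1))"
          using r0(2)[of s] s cl by (intro mult_right_mono) auto
        finally show ?thesis
          using True s fnn[of s] cl A1'
          by (simp add: V_def tp_def[symmetric] ennreal_mult'[symmetric] ennreal_leI)
      qed (auto simp: tp_def[symmetric])
    qed
    also have "\<dots> = (\<integral>\<^sup>+s. V s * indicator {0<..<s0} s \<partial>F)"
      by (rule nn_integral_local_density[OF kpD(1) fm dens, symmetric]) auto
    also have "\<dots> = (\<integral>\<^sup>+s. V s \<partial>F)"
      using tm tp r by (intro nn_integral_cong) (auto simp: V_def indicator_def)
    also have "\<dots> \<le> (\<integral>\<^sup>+s. emeasure (K s) ?W \<partial>F)"
      by (intro nn_integral_mono_AE) (rule eventually_mono[OF ne], use low in blast)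
    also have "\<dots> = emeasure (F \<bind> K) ?W" by (simp add: kpD)
    finally show "ennreal (kappa_minus \<alpha> \<beta> cplus cK * L * h powr (\<alpha> + \<beta> + 2)) \<le> \<dots>" .
  qed
  \<comment> \<open>\<open>ennreal\<close> truncates negative reals to 0, so the upper bound must be
    nonnegative before the inequality can be read in the reals.\<close>
  have nn: "kappa_plus \<alpha> \<beta> cminus cK * L * h powr (\<alpha> + \<beta> + 2) \<ge> 0" for h
    using A1' pos cu by (simp add: kappa_plus_def cu_def[symmetric] Beta_def Gamma_real_pos less_imp_le)
  interpret Q: prob_space "F \<bind> K" by (rule kpD)
  have "\<forall>\<^sub>F h in at_right 0. 0 < h \<and> h < cminus * r \<and> h < \<eta>"
    unfolding eventually_at_right_field
    using r pos \<eta>(1) by (intro exI[of _ "min (cminus * r) \<eta>"]) auto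
  then show ?thesis
  proof eventually_elim
    case (elim h)
    with win[of h] show ?case
      unfolding Q.emeasure_eq_measure by (simp add: nn ennreal_le_iff del: ennreal_plus)
  qed
qed

section \<open>Tools for comparing two pairs with the same observed law\<close>

lemma kappa_minus_pos:
  assumes "A6_coeff \<beta> sR K cK" "\<alpha> \<ge> 0" "\<beta> \<ge> 0" "c > 0"
  shows "kappa_minus \<alpha> \<beta> c cK > 0"
  using A6_coeffD(1)[OF assms(1)] assms(2-)
  by (simp add: kappa_minus_def Beta_def Gamma_real_pos)

text \<open>Dividing by h^p gives A \<le> B h^(q-p). If q > p the right side tends to 0,
  contradicting A > 0.\<close>

lemma powr_exponent_le_of_eventually_le:
  fixes A B p q :: real
  assumes "A > 0" and ev: "\<forall>\<^sub>F h in at_right 0. A * h powr p \<le> B * h powr q"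
  shows "q \<le> p"
proof (rule ccontr)
  assume "\<not> q \<le> p"
  have "((\<lambda>h. B * h powr (q - p)) \<longlongrightarrow> B * 0 powr (q - p)) (at_right 0)"
    using \<open>\<not> q \<le> p\<close> by (intro tendsto_intros) (auto simp: eventually_at_filter)
  then have "((\<lambda>h. B * h powr (q - p)) \<longlongrightarrow> 0) (at_right 0)" by simp
  moreover have "\<forall>\<^sub>F h in at_right 0. A \<le> B * h powr (q - p)"
    using ev eventually_at_right_less
    by eventually_elim (simp add: powr_diff field_simps)
  ultimately have "A \<le> 0" by (intro tendsto_lowerbound) auto
  with \<open>A > 0\<close> show False by simp
qed

text \<open>If a < b, every window of length h < b - a lies in the null set below b. Applied with
  the roles of two pairs exchanged, this shows that the observed law determines the
  endpoint.\<close>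

lemma endpoint_le_of_eventually_pos:
  fixes a b :: real
  assumes sets: "sets Q = sets borel" and null: "emeasure Q {..<ennreal b} = 0" and "a \<ge> 0"
    and pos: "\<forall>\<^sub>F h in at_right 0. 0 < measure Q {ennreal a..ennreal (a + h)}"
  shows "b \<le> a"
proof (rule ccontr)
  assume "\<not> b \<le> a"
  then have "\<forall>\<^sub>F h in at_right 0. h < b - a"
    unfolding eventually_at_right_field by (intro exI[of _ "b - a"]) auto
  with pos eventually_at_right_less have "\<forall>\<^sub>F h::real in at_right 0. False"
  proof eventually_elim
    case (elim h)
    then have "ennreal (a + h) < ennreal b" using \<open>a \<ge> 0\<close> by (intro ennreal_lessI) auto
    then have "{ennreal a..ennreal (a + h)} \<subseteq> {..<ennreal b}" by (auto simp del: ennreal_plus)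
    then have "emeasure Q {ennreal a..ennreal (a + h)} \<le> emeasure Q {..<ennreal b}"
      by (intro emeasure_mono) (auto simp: sets)
    with null have "measure Q {ennreal a..ennreal (a + h)} = 0"
      by (simp add: measure_def)
    with elim show False by simp
  qed
  then show False by simp
qed

section \<open>Identifiability of the shape index\<close>

theorem corollary4p3:
  fixes \<beta> bbar cminus cplus \<tau> s0bar sR sA :: real
  assumes "admissible_constants \<beta> bbar cminus cplus \<tau> s0bar sR sA"
  shows "(\<forall>F K F' K'. (F, K) \<in> M_reg \<beta> bbar cminus cplus \<tau> s0bar sR sA \<and>
             (F', K') \<in> M_reg \<beta> bbar cminus cplus \<tau> s0bar sR sA \<and>
             F \<bind> K = F' \<bind> K' \<longrightarrow>
             (\<forall>\<alpha> L \<alpha>' L'. A1_params s0bar F \<alpha> L \<and> A1_params s0bar F' \<alpha>' L' \<longrightarrow> \<alpha> = \<alpha>'))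
       \<and> (\<forall>F K. (F, K) \<in> M_reg \<beta> bbar cminus cplus \<tau> s0bar sR sA \<longrightarrow>
             (\<forall>\<alpha> L a cK. A1_params s0bar F \<alpha> L \<and> (lower_end K \<longlongrightarrow> a) (at_right 0) \<and>
                A6_coeff \<beta> sR K cK \<longrightarrow>
                (\<forall>\<^sub>F h in at_right 0.
                   kappa_minus \<alpha> \<beta> cplus cK * L * h powr (\<alpha> + \<beta> + 2)
                     \<le> measure (F \<bind> K) {ennreal a..ennreal (a + h)} \<and>
                   measure (F \<bind> K) {ennreal a..ennreal (a + h)}
                     \<le> kappa_plus \<alpha> \<beta> cminus cK * L * h powr (\<alpha> + \<beta> + 2))))"
proof -
  let ?M = "M_reg \<beta> bbar cminus cplus \<tau> s0bar sR sA"
  have adm: "\<beta> \<ge> 0" "0 < cminus" "cminus \<le> cplus" "0 < sR" "0 < s0bar"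
    using assms by (auto simp: admissible_constants_def)
  have bounds: "\<forall>\<^sub>F h in at_right 0.
           kappa_minus \<alpha> \<beta> cplus cK * L * h powr (\<alpha> + \<beta> + 2)
             \<le> measure (F \<bind> K) {ennreal a..ennreal (a + h)} \<and>
           measure (F \<bind> K) {ennreal a..ennreal (a + h)}
             \<le> kappa_plus \<alpha> \<beta> cminus cK * L * h powr (\<alpha> + \<beta> + 2)"
    if "(F, K) \<in> ?M" "A1_params s0bar F \<alpha> L" "(lower_end K \<longlongrightarrow> a) (at_right 0)" "A6_coeff \<beta> sR K cK"
    for F K \<alpha> L a cK
    using that adm by (intro observed_window_bounds[where sR = sR and s0bar = s0bar]) (auto simp: M_reg_def)
  \<comment> \<open>A one-sided claim, to be used in both orders of the two pairs. Exponents can be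
    compared only on a common window, so the second half is conditional on equal endpoints.\<close>
  have le: "a' \<le> a \<and> (a = a' \<longrightarrow> \<alpha>' \<le> \<alpha>)"
    if m: "(F, K) \<in> ?M" "(F', K') \<in> ?M" and Q: "F \<bind> K = F' \<bind> K'"
      and A1: "A1_params s0bar F \<alpha> L" "A1_params s0bar F' \<alpha>' L'"
      and a: "(lower_end K \<longlongrightarrow> a) (at_right 0)" "(lower_end K' \<longlongrightarrow> a') (at_right 0)"
    for F K F' K' \<alpha> L \<alpha>' L' a a'
  proof -
    obtain cK cK' where A6: "A6_coeff \<beta> sR K cK" "A6_coeff \<beta> sR K' cK'"
      using m by (auto simp: M_reg_def A6_def)
    have L: "L > 0" "\<alpha> \<ge> 0" "emeasure F' {0} = 0" using A1 by (auto simp: A1_params_def)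
    have kp: "kernel_pair F K" "kernel_pair F' K'" and A5: "A5 cminus cplus sR K" "A5 cminus cplus sR K'"
      using m by (auto simp: M_reg_def)
    note b = bounds[OF m(1) A1(1) a(1) A6(1)] bounds[OF m(2) A1(2) a(2) A6(2)]
    have k: "kappa_minus \<alpha> \<beta> cplus cK * L > 0"
      using kappa_minus_pos[OF A6(1) L(2) adm(1), of cplus] L adm by simp
    have "\<forall>\<^sub>F h in at_right 0. 0 < measure (F \<bind> K) {ennreal a..ennreal (a + h)}"
      using b(1) eventually_at_right_less
    proof eventually_elim
      case (elim h)
      then have "0 < kappa_minus \<alpha> \<beta> cplus cK * L * h powr (\<alpha> + \<beta> + 2)" using k by simp
      with elim show ?case by linarith
    qed
    then have "a' \<le> a"
      by (rule endpoint_le_of_eventually_pos[OF kernel_pairD(9)[OF kp(1)]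
            observed_below_endpoint[OF kp(2) L(3) A5(2) a(2), folded Q] A5D(1)[OF A5(1) a(1)]])
    moreover have "\<alpha>' \<le> \<alpha>" if "a = a'"
    proof -
      \<comment> \<open>The lower bound of the first pair meets the upper bound of the second on the
        same window mass. The constants may differ between the pairs; \<beta> is shared and cancels
        from the exponents.\<close>
      have "\<forall>\<^sub>F h in at_right 0. kappa_minus \<alpha> \<beta> cplus cK * L * h powr (\<alpha> + \<beta> + 2)
          \<le> kappa_plus \<alpha>' \<beta> cminus cK' * L' * h powr (\<alpha>' + \<beta> + 2)"
        using b by eventually_elim (use that Q in auto)
      from powr_exponent_le_of_eventually_le[OF k this] show ?thesis by simp
    qed
    ultimately show ?thesis by blast
  qed
  have "\<alpha> = \<alpha>'"
    if m: "(F, K) \<in> ?M" "(F', K') \<in> ?M" and Q: "F \<bind> K = F' \<bind> K'"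
      and A1: "A1_params s0bar F \<alpha> L" "A1_params s0bar F' \<alpha>' L'"
    for F K F' K' \<alpha> L \<alpha>' L'
  proof -
    obtain a a' where a: "(lower_end K \<longlongrightarrow> a) (at_right 0)" "(lower_end K' \<longlongrightarrow> a') (at_right 0)"
      using m by (auto simp: M_reg_def A5_def)
    show ?thesis
      using le[OF m Q A1 a] le[OF m(2,1) Q[symmetric] A1(2,1) a(2,1)] by auto
  qed
  with bounds show ?thesis by blast
qed

end
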